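(* Let $G=(V,E)$ be a finite connected simple bipartite graph. Then every load distribution on $G$ can be reduced to a single-level tree distribution without decreasing the flow: for every load distribution $\vec m=(m_v)_{v\in V}$ on $G$ with total load $D=\sum_{v\in V}m_v$, there exists a single-level tree distribution $\vec m'=(m'_v)_{v\in V}$ on $G$ with the same total load $\sum_{v\in V}m'_v=D$ such that $\mathcal F(\vec m')\ge \mathcal F(\vec m)$.
   Context: A load distribution on a finite graph $G=(V,E)$ is a vector $\vec m=(m_v)_{v\in V}$ of real numbers $m_v\ge 0$; its total load is $D=\sum_{v\in V}m_v$. The flow of $\vec m$ is $$\mathcal F(\vec m)=\sum_{\{u,v\}\in E} m_u m_v,$$ where each (undirected) edge is counted once. A single-level tree is a star: a root node together with leaf nodes, each adjacent to the root. A load distribution $\vec m'$ on $G$ is a single-level tree distribution if its non-zero loads lie on a star in $G$, i.e. there is a vertex $r\in V$ such that $m'_v=0$ for every vertex $v\ne r$ that is not adjacent to $r$. *)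

theory Defs
  imports Complex_Main "Graph_Theory.Digraph_Component"
begin

text \<open>
  The locale predicate \<^const>\<open>graph\<close> represents a finite simple undirected graph as a symmetric
  digraph: each undirected edge between \<open>u\<close> and \<open>v\<close> occurs as the two arcs \<open>u \<rightarrow> v\<close> and \<open>v \<rightarrow> u\<close>.
  Passing to the sets of endpoints identifies these two arcs, so that each edge is counted once.
\<close>

definition uedges :: "('a, 'b) pre_digraph \<Rightarrow> 'a set set" where
  "uedges G = (\<lambda>e. {tail G e, head G e}) ` arcs G"

definition bipartite :: "('a, 'b) pre_digraph \<Rightarrow> bool" where
  "bipartite G \<longleftrightarrow> (\<exists>X Y. verts G = X \<union> Y \<and> X \<inter> Y = {} \<and> arcs_ends G \<subseteq> X \<times> Y \<union> Y \<times> X)"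

text \<open>
  A load vector on \<open>G\<close> is a function on the vertex type. Only its values on \<open>verts G\<close> are
  ever referred to.
\<close>

definition load_distribution :: "('a, 'b) pre_digraph \<Rightarrow> ('a \<Rightarrow> real) \<Rightarrow> bool" where
  "load_distribution G m \<longleftrightarrow> (\<forall>v\<in>verts G. 0 \<le> m v)"

definition total_load :: "('a, 'b) pre_digraph \<Rightarrow> ('a \<Rightarrow> real) \<Rightarrow> real" where
  "total_load G m = (\<Sum>v\<in>verts G. m v)"

text \<open>For a loopfree graph, every edge \<open>e = {u, v}\<close> has \<open>u \<noteq> v\<close>, so the product over \<open>e\<close> is \<open>m u * m v\<close>.\<close>

definition flow :: "('a, 'b) pre_digraph \<Rightarrow> ('a \<Rightarrow> real) \<Rightarrow> real" where
  "flow G m = (\<Sum>e\<in>uedges G. \<Prod>v\<in>e. m v)"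

definition single_level_tree_distribution :: "('a, 'b) pre_digraph \<Rightarrow> ('a \<Rightarrow> real) \<Rightarrow> bool" where
  "single_level_tree_distribution G m \<longleftrightarrow> load_distribution G m \<and>
     (\<exists>r\<in>verts G. \<forall>v\<in>verts G. v \<noteq> r \<and> \<not> r \<rightarrow>\<^bsub>G\<^esub> v \<longrightarrow> m v = 0)"

end

theory Submission
  imports Defs
begin

text \<open>
  In a bipartite graph with parts of loads \<open>A\<close> and \<open>B\<close>, the flow is at most
  \<open>A * B \<le> ((A + B) / 2)\<^sup>2\<close>. Placing half of the total load on each end of any single edge
  already achieves this bound, and an edge is a star.
\<close>

text \<open>Bipartiteness and adjacency speak of \<open>arcs_ends\<close>, while the flow sums over
  \<open>uedges\<close>; this links the two.\<close>

lemma uedges_eq_ends: "uedges G = (\<lambda>(u, v). {u, v}) ` arcs_ends G"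
  unfolding uedges_def arcs_ends_def arc_to_ends_def by (simp add: image_image)

lemma finite_uedges: "finite (arcs G) \<Longrightarrow> finite (uedges G)"
  unfolding uedges_def by simp

lemma prod_uedge_nonneg:
  assumes "wf_digraph G" "load_distribution G m" "e \<in> uedges G"
  shows "0 \<le> (\<Prod>v\<in>e. m v)"
proof (rule prod_nonneg)
  fix v assume "v \<in> e"
  with assms(1,3) have "v \<in> verts G"
    unfolding uedges_def by (auto dest: wf_digraph.wellformed)
  with assms(2) show "0 \<le> m v" unfolding load_distribution_def by blast
qed

text \<open>Compare \<open>G\<close> with the complete bipartite graph on its two parts
  \<open>X\<close> and \<open>Y\<close>: extra edges only add nonnegative terms, and the larger flow
  factors as \<open>sum m X * sum m Y\<close>.\<close>

lemma bipartite_flow_le: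
  assumes "finite (verts G)" and bip: "bipartite G" and m: "load_distribution G m"
  shows "flow G m \<le> (total_load G m / 2)\<^sup>2"
proof -
  obtain X Y where XY: "verts G = X \<union> Y" "X \<inter> Y = {}" "arcs_ends G \<subseteq> X \<times> Y \<union> Y \<times> X"
    using bip unfolding bipartite_def by blast
  have fin: "finite X" "finite Y"
    using XY(1) assms(1) by simp_all
  have nonneg: "0 \<le> m v" if "v \<in> X \<union> Y" for v
    using m that XY(1) unfolding load_distribution_def by simp
  let ?pair = "\<lambda>(x, y). {x, y}"
  \<comment> \<open>Since \<open>X\<close> and \<open>Y\<close> are disjoint, an unordered pair
    determines which endpoint lies in \<open>X\<close>, so edges can be indexed by ordered
    pairs.\<close>
  have inj: "inj_on ?pair (X \<times> Y)"
    using XY(2) by (auto simp: inj_on_def doubleton_eq_iff)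
  \<comment> \<open>A product over the set \<open>{x, y}\<close> would collapse to one factor if
    \<open>x = y\<close>; disjointness excludes this.\<close>
  have prod_pair: "(\<Prod>v\<in>?pair p. m v) = m (fst p) * m (snd p)" if "p \<in> X \<times> Y" for p
    proof -
    have "fst p \<noteq> snd p" using that XY(2) by auto
    then show ?thesis by (simp add: case_prod_unfold)
  qed
  \<comment> \<open>Arcs from \<open>Y\<close> to \<open>X\<close> are covered as well, because
    \<open>{y, x} = {x, y}\<close>.\<close>
  have "uedges G \<subseteq> ?pair ` (X \<times> Y)"
    using XY(3) unfolding uedges_eq_ends by (fastforce simp: insert_commute)
  then have "flow G m \<le> (\<Sum>e\<in>?pair ` (X \<times> Y). \<Prod>v\<in>e. m v)"
    unfolding flow_def using fin nonneg by (intro sum_mono2) (auto intro!: prod_nonneg)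
  also have "\<dots> = (\<Sum>p\<in>X \<times> Y. m (fst p) * m (snd p))"
    using inj prod_pair by (simp add: sum.reindex)
  also have "\<dots> = sum m X * sum m Y"
    by (simp add: sum_product sum.cartesian_product case_prod_unfold)
  \<comment> \<open>The right side exceeds the left by
    \<open>((sum m X - sum m Y) / 2)\<^sup>2\<close>.\<close>
  also have "\<dots> \<le> ((sum m X + sum m Y) / 2)\<^sup>2"
    using zero_le_power2[of "sum m X - sum m Y"] by (simp add: power2_eq_square field_simps)
  also have "sum m X + sum m Y = total_load G m"
    unfolding total_load_def using XY(1,2) fin by (simp add: sum.union_disjoint)
  finally show ?thesis .
qed

lemma exists_edge_distribution:
  assumes G: "digraph G" and uv: "u \<rightarrow>\<^bsub>G\<^esub> v" and D: "0 \<le> D"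
  shows "\<exists>m'. single_level_tree_distribution G m' \<and> total_load G m' = D \<and> (D / 2)\<^sup>2 \<le> flow G m'"
proof -
  interpret digraph G by (rule G)
  let ?m = "\<lambda>w. if w \<in> {u, v} then D / 2 else 0"
  have ends: "u \<in> verts G" "v \<in> verts G" "u \<noteq> v"
    using uv adj_not_same by auto
  have ld: "load_distribution G ?m"
    using D unfolding load_distribution_def by simp
  \<comment> \<open>The root is \<open>u\<close>; the only other vertex with load is its neighbour
    \<open>v\<close>.\<close>
  have "single_level_tree_distribution G ?m"
    using ld uv ends(1) unfolding single_level_tree_distribution_def by auto
  moreover have "total_load G ?m = D"
  proof -
    have "total_load G ?m = (\<Sum>w\<in>{u, v}. D / 2)"
      unfolding total_load_def using ends
      by (intro sum.mono_neutral_cong_right) auto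
    then show ?thesis using ends(3) by simp
  qed
  moreover have "(D / 2)\<^sup>2 \<le> flow G ?m"
  proof -
    have mem: "{u, v} \<in> uedges G"
      using uv unfolding uedges_eq_ends by force
    \<comment> \<open>All edge products are nonnegative, so the single term of the edge
      \<open>{u, v}\<close> bounds the flow from below.\<close>
    have "(\<Prod>w\<in>{u, v}. ?m w) \<le> flow G ?m"
      unfolding flow_def
      using mem prod_uedge_nonneg[OF wf_digraph_axioms ld] finite_uedges[OF finite_arcs]
      by (intro member_le_sum[where f = "\<lambda>e. \<Prod>w\<in>e. ?m w"]) auto
    then show ?thesis using ends(3) by (simp add: power2_eq_square)
  qed
  ultimately show ?thesis by blast
qed

text \<open>This settles the case with no edge to hold the two halves of the load. The symmetric
  closure of the empty relation is empty, so a vertex reaches only itself, while connectedness also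
  supplies at least one vertex.\<close>

lemma connected_arcs_empty:
  assumes "Digraph_Component.connected G" and "arcs_ends G = {}"
  shows "\<exists>r. verts G = {r}"
proof -
  obtain r where r: "r \<in> verts G"
    using assms(1) unfolding connected_conv by blast
  have "v = r" if "v \<in> verts G" for v
  proof -
    have "(r, v) \<in> rtrancl_on (verts G) {}"
      using assms r that unfolding connected_conv by (auto simp: symcl_def)
    then show ?thesis by (induction rule: rtrancl_on_induct) auto
  qed
  then show ?thesis using r by blast
qed

theorem theorem1:
  fixes G :: "('a, 'b) pre_digraph"
    and m :: "'a \<Rightarrow> real"
  assumes "graph G"
    and "Digraph_Component.connected G"
    and "bipartite G"
    and "load_distribution G m"
  shows "\<exists>m'. single_level_tree_distribution G m' \<and>
           total_load G m' = total_load G m \<and>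
           flow G m' \<ge> flow G m"
proof -
  interpret graph G by (rule assms(1))
  show ?thesis
  proof (cases "arcs_ends G = {}")
    case True
    then obtain r where "verts G = {r}"
      using connected_arcs_empty assms(2) by blast
    \<comment> \<open>On a single vertex \<open>m\<close> is already supported on a star with root
      \<open>r\<close>, so \<open>m\<close> itself is the witness.\<close>
    then have "single_level_tree_distribution G m"
      using assms(4) unfolding single_level_tree_distribution_def by simp
    then show ?thesis by blast
  next
    case False
    then obtain u v where uv: "u \<rightarrow>\<^bsub>G\<^esub> v" by auto
    have "0 \<le> total_load G m"
      using assms(4) unfolding total_load_def load_distribution_def by (simp add: sum_nonneg)
    then obtain m' where "single_level_tree_distribution G m'" "total_load G m' = total_load G m"
        "(total_load G m / 2)\<^sup>2 \<le> flow G m'"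
      using exists_edge_distribution[OF digraph_axioms uv] by blast
    then show ?thesis
      using bipartite_flow_le[OF finite_verts assms(3,4)] order_trans by blast
  qed
qed

end
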